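(* Let $s\in\mathbb{C}$ with $\Re(s)>1$, and let $$N_{\alpha,0}=\sum_{n=1}^\infty \frac{1}{n^s}\,\overline{\Pi}_0(n),$$ i.e. the operator associated with $\alpha(n)=n^{-s}$. Then $N_{\alpha,0}$ is a bounded operator on $H^2$ with $$\|N_{\alpha,0}\|\le \zeta(\Re(s)),$$ and its Berezin symbol satisfies $$\widetilde{N_{\alpha,0}}(\lambda)=\sum_{n=1}^\infty \frac{1}{n^s}\,\frac{1-|\lambda|^2}{1-|\lambda|^{2n}}\,|\lambda|^{2n}\quad(\lambda\in\mathbb{D}),\qquad \lim_{|\lambda|\to1}\widetilde{N_{\alpha,0}}(\lambda)=\zeta(s+1).$$ Here $\zeta$ is the Riemann zeta function.
   Context: $\mathbb{D}=\{z\in\mathbb{C}:|z|<1\}$ and $H^2$ is the Hardy space on $\mathbb{D}$, with orthonormal basis $e_r(z)=z^r$, $r=0,1,2,\dots$; the number state $|r\rangle$ is identified with $e_r$, and $|r\rangle\langle r|$ denotes the orthogonal projection onto the line spanned by $e_r$. For $n\ge1$, $$\overline{\Pi}_0(n)=\sum_{l=1}^\infty |ln\rangle\langle ln|$$ is the orthogonal projection onto the closed span of $\{e_{ln}: l\ge 1\}$. The reproducing kernel of $H^2$ is $k_\lambda(z)=\frac{1}{1-\overline{\lambda}z}$, and $\widehat{k}_\lambda=k_\lambda/\|k_\lambda\|$. The Berezin symbol of a bounded linear operator $A$ on $H^2$ is the function $\widetilde{A}(\lambda)=\langle A\widehat{k}_\lambda,\widehat{k}_\lambda\rangle$, $\lambda\in\mathbb{D}$.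 *)

theory Defs
  imports "HOL-Complex_Analysis.Complex_Analysis"
begin

section \<open>The Hardy space of the unit disc\<close>

definition taylor_coeff :: "(complex \<Rightarrow> complex) \<Rightarrow> nat \<Rightarrow> complex" where
  "taylor_coeff f n = (deriv ^^ n) f 0 / fact n"

text \<open>
  The elements are the holomorphic functions on the open unit disc with square-summable Taylor
  coefficients at the origin.  They are extended by zero outside the disc, so that equality in the
  type is equality of functions on the disc.
\<close>

definition hardy_set :: "(complex \<Rightarrow> complex) set" where
  "hardy_set = {f. f holomorphic_on ball 0 1 \<and> (\<forall>z. z \<notin> ball 0 1 \<longrightarrow> f z = 0) \<and>
                   summable (\<lambda>n. (norm (taylor_coeff f n))\<^sup>2)}"

lemma taylor_coeff_add:
  assumes "f holomorphic_on ball 0 1" "g holomorphic_on ball 0 1"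
  shows "taylor_coeff (\<lambda>z. f z + g z) n = taylor_coeff f n + taylor_coeff g n"
  using higher_deriv_add[OF assms, of 0 n] by (simp add: taylor_coeff_def add_divide_distrib)

lemma taylor_coeff_cmult:
  assumes "f holomorphic_on ball 0 1"
  shows "taylor_coeff (\<lambda>z. c * f z) n = c * taylor_coeff f n"
  using higher_deriv_cmult[OF assms, of 0 n c] by (simp add: taylor_coeff_def)

lemma taylor_coeff_zero: "taylor_coeff (\<lambda>z. 0) n = 0"
  by (simp add: taylor_coeff_def)

lemma taylor_coeff_sums:
  assumes "f holomorphic_on ball 0 1" "norm z < 1"
  shows "(\<lambda>n. taylor_coeff f n * z ^ n) sums f z"
  using holomorphic_power_series[of f 0 1 z] assms by (simp add: taylor_coeff_def)

lemma power_series_taylor_coeff: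
  assumes "\<And>z. norm z < 1 \<Longrightarrow> (\<lambda>n. a n * z ^ n) sums f z"
  shows "f holomorphic_on ball 0 1" and "taylor_coeff f n = a n"
proof -
  show hol: "f holomorphic_on ball 0 1"
    using assms by (intro power_series_holomorphic[where a = a]) auto
  define F where "F = Abs_fps a"
  have ev: "eval_fps F z = f z" if "norm z < 1" for z
    using assms[OF that] by (simp add: eval_fps_def F_def sums_iff)
  have "fps_conv_radius F \<ge> 1"
    unfolding fps_conv_radius_def
  proof (rule conv_radius_geI_ex')
    fix r :: real assume "0 < r" "ereal r < 1"
    then have "norm (complex_of_real r) < 1" by simp
    from assms[OF this] show "summable (\<lambda>n. fps_nth F n * of_real r ^ n)"
      by (simp add: F_def sums_iff)
  qed
  then have "fps_conv_radius F > 0"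
    using less_le_trans[of 0 1 "fps_conv_radius F"] by simp
  moreover have "eventually (\<lambda>z. z \<in> ball 0 1) (nhds (0::complex))"
    by (intro eventually_nhds_in_open) auto
  then have "eventually (\<lambda>z. eval_fps F z = f z) (nhds 0)"
    by eventually_elim (simp add: ev)
  ultimately have "f has_fps_expansion F"
    by (simp add: has_fps_expansion_def)
  then show "taylor_coeff f n = a n"
    using fps_nth_fps_expansion[of f F n] by (simp add: taylor_coeff_def F_def)
qed

lemma square_summable_add:
  fixes a b :: "nat \<Rightarrow> complex"
  assumes "summable (\<lambda>n. (norm (a n))\<^sup>2)" "summable (\<lambda>n. (norm (b n))\<^sup>2)"
  shows "summable (\<lambda>n. (norm (a n + b n))\<^sup>2)"
proof (rule summable_comparison_test')
  show "summable (\<lambda>n. 2 * (norm (a n))\<^sup>2 + 2 * (norm (b n))\<^sup>2)"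
    using assms by (intro summable_add summable_mult)
  fix n :: nat
  have "(norm (a n + b n))\<^sup>2 \<le> (norm (a n) + norm (b n))\<^sup>2"
    by (intro power_mono norm_triangle_ineq) simp
  also have "\<dots> \<le> 2 * (norm (a n))\<^sup>2 + 2 * (norm (b n))\<^sup>2"
    using zero_le_power2[of "norm (a n) - norm (b n)"] by (simp add: power2_sum power2_diff)
  finally show "norm ((norm (a n + b n))\<^sup>2) \<le> 2 * (norm (a n))\<^sup>2 + 2 * (norm (b n))\<^sup>2"
    by simp
qed

lemma square_summable_mult_cnj:
  fixes a b :: "nat \<Rightarrow> complex"
  assumes "summable (\<lambda>n. (norm (a n))\<^sup>2)" "summable (\<lambda>n. (norm (b n))\<^sup>2)"
  shows "summable (\<lambda>n. a n * cnj (b n))"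
proof (rule summable_comparison_test')
  show "summable (\<lambda>n. (norm (a n))\<^sup>2 + (norm (b n))\<^sup>2)"
    using assms by (rule summable_add)
  fix n :: nat
  have "2 * (norm (a n) * norm (b n)) \<le> (norm (a n))\<^sup>2 + (norm (b n))\<^sup>2"
    using zero_le_power2[of "norm (a n) - norm (b n)"] by (simp add: power2_diff)
  moreover have "0 \<le> norm (a n) * norm (b n)" by simp
  ultimately show "norm (a n * cnj (b n)) \<le> (norm (a n))\<^sup>2 + (norm (b n))\<^sup>2"
    unfolding norm_mult complex_mod_cnj by linarith
qed

lemma hardy_set_zero: "(\<lambda>z. 0) \<in> hardy_set"
  by (simp add: hardy_set_def taylor_coeff_zero)

lemma hardy_set_add:
  assumes "f \<in> hardy_set" "g \<in> hardy_set"
  shows "(\<lambda>z. f z + g z) \<in> hardy_set"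
  using assms by (auto simp: hardy_set_def taylor_coeff_add square_summable_add
      intro!: holomorphic_intros)

lemma hardy_set_cmult:
  assumes "f \<in> hardy_set"
  shows "(\<lambda>z. c * f z) \<in> hardy_set"
  using assms by (auto simp: hardy_set_def taylor_coeff_cmult norm_mult power_mult_distrib
      intro!: holomorphic_intros summable_mult)

typedef hardy = hardy_set
  morphisms hardy_fun Abs_hardy
  using hardy_set_zero by blast

setup_lifting type_definition_hardy

definition hcoeff :: "hardy \<Rightarrow> nat \<Rightarrow> complex" where
  "hcoeff f = taylor_coeff (hardy_fun f)"

definition hinner :: "hardy \<Rightarrow> hardy \<Rightarrow> complex" where
  "hinner f g = (\<Sum>n. hcoeff f n * cnj (hcoeff g n))"

lift_definition hscale :: "complex \<Rightarrow> hardy \<Rightarrow> hardy"  (infixr "*\<^sub>C" 75)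
  is "\<lambda>c f z. c * f z" by (rule hardy_set_cmult)

lemma hardy_fun_holomorphic: "hardy_fun f holomorphic_on ball 0 1"
  using hardy_fun[of f] by (simp add: hardy_set_def)

lemma hardy_fun_outside: "\<not> norm z < 1 \<Longrightarrow> hardy_fun f z = 0"
  using hardy_fun[of f] by (simp add: hardy_set_def)

lemma summable_hcoeff: "summable (\<lambda>n. (norm (hcoeff f n))\<^sup>2)"
  using hardy_fun[of f] by (simp add: hardy_set_def hcoeff_def)

lemma hcoeff_sums: "norm z < 1 \<Longrightarrow> (\<lambda>n. hcoeff f n * z ^ n) sums hardy_fun f z"
  unfolding hcoeff_def by (intro taylor_coeff_sums hardy_fun_holomorphic)

lemma hardy_eqI:
  assumes "\<And>n. hcoeff f n = hcoeff g n"
  shows "f = g"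
proof -
  have "hardy_fun f z = hardy_fun g z" for z
  proof (cases "norm z < 1")
    case True
    show ?thesis
      using hcoeff_sums[OF True, of f] hcoeff_sums[OF True, of g] assms
      by (simp add: sums_unique2)
  qed (simp add: hardy_fun_outside)
  then show ?thesis
    by (simp add: hardy_fun_inject[symmetric] fun_eq_iff)
qed

lemma hcoeff_hscale: "hcoeff (c *\<^sub>C f) n = c * hcoeff f n"
  unfolding hcoeff_def hscale.rep_eq by (rule taylor_coeff_cmult[OF hardy_fun_holomorphic])

lemma summable_hinner: "summable (\<lambda>n. hcoeff f n * cnj (hcoeff g n))"
  by (intro square_summable_mult_cnj summable_hcoeff)

instantiation hardy :: real_vector
begin

lift_definition zero_hardy :: hardy is "\<lambda>z. 0" by (rule hardy_set_zero)

lift_definition plus_hardy :: "hardy \<Rightarrow> hardy \<Rightarrow> hardy" is "\<lambda>f g z. f z + g z"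
  by (rule hardy_set_add)

definition uminus_hardy :: "hardy \<Rightarrow> hardy" where "uminus_hardy f = (-1) *\<^sub>C f"

definition minus_hardy :: "hardy \<Rightarrow> hardy \<Rightarrow> hardy" where "minus_hardy f g = f + - g"

definition scaleR_hardy :: "real \<Rightarrow> hardy \<Rightarrow> hardy" where
  "scaleR_hardy r f = complex_of_real r *\<^sub>C f"

instance
  by standard
    (simp_all add: hardy_fun_inject[symmetric] fun_eq_iff plus_hardy.rep_eq zero_hardy.rep_eq
      uminus_hardy_def minus_hardy_def scaleR_hardy_def hscale.rep_eq algebra_simps)

end

lemma hcoeff_zero: "hcoeff 0 n = 0"
  by (simp add: hcoeff_def zero_hardy.rep_eq taylor_coeff_zero)

lemma hcoeff_add: "hcoeff (f + g) n = hcoeff f n + hcoeff g n"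
  unfolding hcoeff_def plus_hardy.rep_eq by (intro taylor_coeff_add hardy_fun_holomorphic)

lemma hcoeff_scaleR: "hcoeff (r *\<^sub>R f) n = complex_of_real r * hcoeff f n"
  by (simp add: scaleR_hardy_def hcoeff_hscale)

lemma hinner_add_left: "hinner (f + g) h = hinner f h + hinner g h"
  by (simp add: hinner_def hcoeff_add distrib_right suminf_add summable_hinner)

lemma hinner_hscale_left: "hinner (c *\<^sub>C f) g = c * hinner f g"
  by (simp add: hinner_def hcoeff_hscale mult.assoc suminf_mult summable_hinner)

lemma hinner_commute: "hinner f g = cnj (hinner g f)"
proof -
  have "(\<lambda>n. cnj (hcoeff g n * cnj (hcoeff f n))) sums cnj (hinner g f)"
    unfolding sums_cnj hinner_def by (intro summable_sums summable_hinner)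
  then show ?thesis
    by (simp add: hinner_def sums_iff mult.commute)
qed

lemma hinner_self: "hinner f f = complex_of_real (\<Sum>n. (norm (hcoeff f n))\<^sup>2)"
  by (simp add: hinner_def complex_norm_square[symmetric] suminf_of_real[OF summable_hcoeff]
      flip: of_real_power)

instantiation hardy :: real_inner
begin

definition inner_hardy :: "hardy \<Rightarrow> hardy \<Rightarrow> real" where "inner_hardy f g = Re (hinner f g)"

definition norm_hardy :: "hardy \<Rightarrow> real" where "norm_hardy f = sqrt (Re (hinner f f))"

definition sgn_hardy :: "hardy \<Rightarrow> hardy" where "sgn_hardy f = f /\<^sub>R norm f"

definition dist_hardy :: "hardy \<Rightarrow> hardy \<Rightarrow> real" where "dist_hardy f g = norm (f - g)"

definition uniformity_hardy :: "(hardy \<times> hardy) filter" where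
  "uniformity_hardy = (INF e\<in>{0<..}. principal {(x, y). dist x y < e})"

definition open_hardy :: "hardy set \<Rightarrow> bool" where
  "open_hardy U \<longleftrightarrow> (\<forall>x\<in>U. eventually (\<lambda>(x', y). x' = x \<longrightarrow> y \<in> U) uniformity)"

instance
proof
  fix f g h :: hardy and r :: real
  show "inner f g = inner g f"
    using hinner_commute[of f g] by (simp add: inner_hardy_def)
  show "inner (f + g) h = inner f h + inner g h"
    by (simp add: inner_hardy_def hinner_add_left)
  show "inner (r *\<^sub>R f) g = r * inner f g"
    by (simp add: inner_hardy_def scaleR_hardy_def hinner_hscale_left)
  show "0 \<le> inner f f"
    by (simp add: inner_hardy_def hinner_self suminf_nonneg summable_hcoeff)
  have "f = 0" if "inner f f = 0"
  proof (rule hardy_eqI)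
    fix n
    have "(\<Sum>n. (norm (hcoeff f n))\<^sup>2) = 0"
      using that by (simp add: inner_hardy_def hinner_self)
    then show "hcoeff f n = hcoeff 0 n"
      using suminf_eq_zero_iff[OF summable_hcoeff[of f]] by (simp add: hcoeff_zero)
  qed
  moreover have "inner (0 :: hardy) 0 = 0"
    by (simp add: inner_hardy_def hinner_def hcoeff_zero)
  ultimately show "inner f f = 0 \<longleftrightarrow> f = 0"
    by blast
qed (simp_all add: sgn_hardy_def dist_hardy_def uniformity_hardy_def open_hardy_def
      norm_hardy_def inner_hardy_def)

end

lemma norm_hardy_eq: "norm f = sqrt (\<Sum>n. (norm (hcoeff f n))\<^sup>2)" for f :: hardy
  by (simp add: norm_hardy_def hinner_self)

section \<open>Number states, reproducing kernel, Berezin symbol\<close>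

definition hardy_of :: "(complex \<Rightarrow> complex) \<Rightarrow> hardy" where
  "hardy_of f = Abs_hardy (\<lambda>z. if norm z < 1 then f z else 0)"

lemma hardy_of_power_series:
  assumes "\<And>z. norm z < 1 \<Longrightarrow> (\<lambda>n. a n * z ^ n) sums f z"
    and "summable (\<lambda>n. (norm (a n))\<^sup>2)"
  shows "norm z < 1 \<Longrightarrow> hardy_fun (hardy_of f) z = f z" and "hcoeff (hardy_of f) n = a n"
proof -
  let ?f = "\<lambda>z. if norm z < 1 then f z else 0"
  have *: "(\<lambda>n. a n * z ^ n) sums ?f z" if "norm z < 1" for z
    using assms(1)[OF that] that by simp
  note coeff = power_series_taylor_coeff[OF *, simplified]
  have "?f \<in> hardy_set"
    using coeff assms(2) by (simp add: hardy_set_def)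
  then have eq: "hardy_fun (hardy_of f) = ?f"
    by (simp add: hardy_of_def Abs_hardy_inverse)
  show "norm z < 1 \<Longrightarrow> hardy_fun (hardy_of f) z = f z" and "hcoeff (hardy_of f) n = a n"
    by (simp_all add: eq hcoeff_def coeff)
qed

definition number_state :: "nat \<Rightarrow> hardy" where
  "number_state r = hardy_of (\<lambda>z. z ^ r)"

definition kernel :: "complex \<Rightarrow> hardy" where
  "kernel w = hardy_of (\<lambda>z. 1 / (1 - cnj w * z))"

definition berezin :: "(hardy \<Rightarrow> hardy) \<Rightarrow> complex \<Rightarrow> complex" where
  "berezin A w = hinner (A (kernel w /\<^sub>R norm (kernel w))) (kernel w /\<^sub>R norm (kernel w))"

text \<open>
  \<open>hardy_of\<close> is meaningful only for functions that do lie in the Hardy space; the following lemmas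
  show this for the number states and for the kernels at points of the disc.
\<close>

lemma number_state:
  shows "norm z < 1 \<Longrightarrow> hardy_fun (number_state r) z = z ^ r"
    and "hcoeff (number_state r) n = (if n = r then 1 else 0)"
proof -
  have "(\<lambda>n. (if n = r then 1 else 0) * z ^ n) sums z ^ r" for z :: complex
    using sums_single[of r "\<lambda>n. z ^ n"] by (simp add: if_distrib[of "\<lambda>x. x * _"] cong: if_cong)
  moreover have "summable (\<lambda>n. (norm (if n = r then 1 else 0 :: complex))\<^sup>2)"
    using summable_single[of r "\<lambda>n. 1 :: real"]
    by (simp add: if_distrib[of "\<lambda>x. (norm x)\<^sup>2"] cong: if_cong)
  ultimately have *: "norm z < 1 \<Longrightarrow> hardy_fun (number_state r) z = z ^ r"
    "hcoeff (number_state r) n = (if n = r then 1 else 0)" for z n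
    unfolding number_state_def
    using hardy_of_power_series[of "\<lambda>n. if n = r then 1 else 0" "\<lambda>z. z ^ r"] by blast+
  show "norm z < 1 \<Longrightarrow> hardy_fun (number_state r) z = z ^ r"
    and "hcoeff (number_state r) n = (if n = r then 1 else 0)"
    using * by blast+
qed

lemma kernel:
  assumes "norm w < 1"
  shows "norm z < 1 \<Longrightarrow> hardy_fun (kernel w) z = 1 / (1 - cnj w * z)"
    and "hcoeff (kernel w) n = cnj w ^ n"
proof -
  have "(\<lambda>n. cnj w ^ n * z ^ n) sums (1 / (1 - cnj w * z))" if "norm z < 1" for z
  proof -
    have "norm (cnj w * z) < 1"
      using mult_strict_mono'[of "norm w" 1 "norm z" 1] assms that by (simp add: norm_mult)
    from geometric_sums[OF this] show ?thesis by (simp add: power_mult_distrib)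
  qed
  moreover have "summable (\<lambda>n. (norm (cnj w ^ n))\<^sup>2)"
  proof -
    have "(norm w)\<^sup>2 < 1" using assms by (simp add: power_less_one_iff abs_square_less_1)
    then have "summable (\<lambda>n. ((norm w)\<^sup>2) ^ n)" by (intro summable_geometric) simp
    then show ?thesis by (simp add: norm_power mult.commute flip: power_mult)
  qed
  ultimately have *: "norm z < 1 \<Longrightarrow> hardy_fun (kernel w) z = 1 / (1 - cnj w * z)"
    "hcoeff (kernel w) n = cnj w ^ n" for z n
    unfolding kernel_def
    using hardy_of_power_series[of "\<lambda>n. cnj w ^ n" "\<lambda>z. 1 / (1 - cnj w * z)"] by blast+
  show "norm z < 1 \<Longrightarrow> hardy_fun (kernel w) z = 1 / (1 - cnj w * z)"
    and "hcoeff (kernel w) n = cnj w ^ n"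
    using * by blast+
qed

lemma reproducing:
  assumes "norm w < 1"
  shows "hinner f (kernel w) = hardy_fun f w"
  using hcoeff_sums[OF assms, of f] by (simp add: hinner_def kernel[OF assms] sums_iff)

lemma number_state_orthonormal:
  "hinner (number_state q) (number_state r) = (if q = r then 1 else 0)"
  using sums_single[of r "\<lambda>n. if n = q then 1 else 0 :: complex"]
  by (auto simp: hinner_def number_state sums_iff if_distrib[of "\<lambda>x. _ * cnj x"] cong: if_cong)

section \<open>The operators\<close>

text \<open>
  Bounded operators are complex-linear; \<^const>\<open>bounded_linear\<close> by itself only asks for
  real-linearity.
\<close>

definition bounded_operator :: "(hardy \<Rightarrow> hardy) \<Rightarrow> bool" where
  "bounded_operator A \<longleftrightarrow> bounded_linear A \<and> (\<forall>c f. A (c *\<^sub>C f) = c *\<^sub>C A f)"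

definition ket_bra :: "nat \<Rightarrow> hardy \<Rightarrow> hardy" where
  "ket_bra r f = hinner f (number_state r) *\<^sub>C number_state r"

text \<open>
  Infinite sums of operators are taken in the strong operator topology, i.e. pointwise in the norm
  of the Hardy space.  Sums over \<open>l \<ge> 1\<close> are written as sums over \<open>Suc l\<close>.
\<close>

definition Pi0bar :: "nat \<Rightarrow> hardy \<Rightarrow> hardy" where
  "Pi0bar n f = (\<Sum>l. ket_bra (Suc l * n) f)"

lemma hardy_with_coeffs:
  assumes "summable (\<lambda>n. (norm (a n))\<^sup>2)"
  shows "\<exists>f. \<forall>n. hcoeff f n = a n"
proof -
  have "(\<lambda>n. a n * z ^ n) sums (\<Sum>n. a n * z ^ n)" if "norm z < 1" for z
  proof -
    have "hcoeff (kernel z) n = cnj (z ^ n)" for n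
      using kernel(2)[OF that] by simp
    then have "summable (\<lambda>n. a n * z ^ n)"
      using square_summable_mult_cnj[OF assms summable_hcoeff[of "kernel z"]] by simp
    then show ?thesis by (rule summable_sums)
  qed
  then have "\<forall>n. hcoeff (hardy_of (\<lambda>z. \<Sum>n. a n * z ^ n)) n = a n"
    using hardy_of_power_series(2)[of a "\<lambda>z. \<Sum>n. a n * z ^ n"] assms by blast
  then show ?thesis ..
qed

lemma hcoeff_ket_bra: "hcoeff (ket_bra r f) k = (if k = r then hcoeff f k else 0)"
proof -
  have "hinner f (number_state r) = hcoeff f r"
    using sums_single[of r "hcoeff f"]
    by (simp add: hinner_def number_state sums_iff if_distrib[of "\<lambda>x. _ * cnj x"] cong: if_cong)
  then show ?thesis
    by (simp add: ket_bra_def hcoeff_hscale number_state)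
qed

lemma hcoeff_sum: "hcoeff (sum F A) k = (\<Sum>x\<in>A. hcoeff (F x) k)"
  by (induction A rule: infinite_finite_induct) (simp_all add: hcoeff_zero hcoeff_add)

lemma hcoeff_diff: "hcoeff (f - g) k = hcoeff f k - hcoeff g k"
  by (simp add: minus_hardy_def uminus_hardy_def hcoeff_add hcoeff_hscale)

text \<open>
  The series defining \<open>Pi0bar\<close> converges, and its sum is the orthogonal projection onto the
  closed span of the states whose number is a positive multiple of \<open>n\<close>.
\<close>

lemma Pi0bar:
  assumes "n \<ge> 1"
  shows "(\<lambda>l. ket_bra (Suc l * n) f) sums Pi0bar n f"
    and "hcoeff (Pi0bar n f) k = (if n dvd k \<and> 0 < k then hcoeff f k else 0)"
proof -
  define b where "b k = (if n dvd k \<and> 0 < k then hcoeff f k else 0)" for k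
  define h where "h k = (norm (b k))\<^sup>2" for k
  have h: "summable h" unfolding h_def
    by (rule summable_comparison_test'[OF summable_hcoeff[of f]]) (simp add: b_def)
  then obtain g where g: "\<And>k. hcoeff g k = b k"
    using hardy_with_coeffs[of b] unfolding h_def[abs_def] by blast
  define S where "S L = (\<Sum>l<L. ket_bra (Suc l * n) f)" for L
  have S: "hcoeff (S L) k = (if k \<le> L * n then b k else 0)" for L k
  proof (induction L)
    case 0
    then show ?case by (simp add: S_def hcoeff_zero b_def)
  next
    case (Suc L)
    have eq: "hcoeff (S (Suc L)) k = hcoeff (S L) k + (if k = Suc L * n then hcoeff f k else 0)"
      by (simp add: S_def hcoeff_add hcoeff_ket_bra)
    consider "k \<le> L * n" | "k = Suc L * n" | "Suc L * n < k" | "L * n < k" "k < Suc L * n"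
      by linarith
    then show ?case
    proof cases
      case 2
      then have "hcoeff (S L) k = 0" using Suc assms by simp
      with 2 show ?thesis using assms unfolding eq b_def by auto
    next
      case 4
      have "\<not> n dvd k"
      proof
        assume "n dvd k"
        then obtain m where "k = m * n" by (metis dvdE mult.commute)
        with 4 have "L < m" "m < Suc L" by (simp_all only: mult_less_cancel2)
        then show False by simp
      qed
      with 4 show ?thesis by (simp add: eq Suc b_def)
    qed (use assms in \<open>auto simp: eq Suc b_def\<close>)
  qed
  have bound: "norm (S L - g) \<le> sqrt (\<Sum>k. h (k + L))" for L
  proof -
    define c where "c k = (norm (hcoeff (S L - g) k))\<^sup>2" for k
    have c: "summable c" unfolding c_def by (rule summable_hcoeff)
    have "k \<le> L * n" if "k < L" for k
      using mult_le_mono[OF less_imp_le[OF that] assms] by simp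
    then have "c k = 0" if "k < L" for k
      using that by (simp add: c_def hcoeff_diff S g)
    then have "(\<Sum>k. c k) = (\<Sum>k. c (k + L))"
      using suminf_minus_initial_segment[OF c, of L] by simp
    also have "\<dots> \<le> (\<Sum>k. h (k + L))"
    proof (rule suminf_le)
      show "summable (\<lambda>k. c (k + L))" "summable (\<lambda>k. h (k + L))"
        using c h by (simp_all only: summable_iff_shift)
    qed (simp add: c_def h_def hcoeff_diff S g)
    finally show ?thesis by (simp add: norm_hardy_eq c_def)
  qed
  have "(\<lambda>L. \<Sum>k. h (k + L)) \<longlonglongrightarrow> 0"
    using tendsto_diff[OF tendsto_const summable_LIMSEQ[OF h], of "suminf h"]
    by (simp add: suminf_minus_initial_segment[OF h])
  then have "(\<lambda>L. sqrt (\<Sum>k. h (k + L))) \<longlonglongrightarrow> 0"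
    using tendsto_real_sqrt by fastforce
  then have "S \<longlonglongrightarrow> g"
    by (intro LIM_zero_cancel[of S] Lim_null_comparison[OF always_eventually[OF allI[OF bound]]])
  then have "(\<lambda>l. ket_bra (Suc l * n) f) sums g"
    by (simp add: sums_def S_def[abs_def])
  moreover from this have "Pi0bar n f = g"
    by (simp add: Pi0bar_def sums_iff)
  ultimately show "(\<lambda>l. ket_bra (Suc l * n) f) sums Pi0bar n f"
    and "hcoeff (Pi0bar n f) k = (if n dvd k \<and> 0 < k then hcoeff f k else 0)"
    by (simp_all add: g b_def)
qed

definition N0 :: "(nat \<Rightarrow> complex) \<Rightarrow> hardy \<Rightarrow> hardy" where
  "N0 \<alpha> f = (\<Sum>n. \<alpha> (Suc n) *\<^sub>C Pi0bar (Suc n) f)"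

text \<open>The Dirichlet series, which is the zeta function only on the half-plane \<open>Re s > 1\<close>.\<close>

definition zeta :: "complex \<Rightarrow> complex" where
  "zeta s = (\<Sum>n. 1 / of_nat (Suc n) powr s)"

end

theory Submission
  imports Defs
begin

text \<open>
  Each projection acts on Taylor coefficients by a mask, so \<open>N0 \<alpha>\<close> multiplies the \<open>k\<close>-th
  coefficient (\<open>k > 0\<close>) by the divisor sum of \<open>\<alpha>\<close> over \<open>n dvd k\<close>, and the \<open>L\<close>-th remainder of the
  series multiplies it by a number of modulus at most \<open>\<Sum>n\<ge>L. norm (\<alpha> (n + 1))\<close>.  Since a coefficient
  multiplier bounded by \<open>C\<close> has norm at most \<open>C\<close>, this gives strong convergence and the norm bound.
  The Berezin symbol is computed termwise, and its boundary limit follows from dominated convergence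
  because \<open>(1 - x) x^n / (1 - x^n) = x^n / (\<Sum>i<n. x^i)\<close> lies in \<open>[0, 1]\<close> and tends to \<open>1 / n\<close>.
\<close>

lemma norm_hardy_le_multiple:
  fixes f g :: hardy
  assumes "\<And>k. norm (hcoeff g k) \<le> C * norm (hcoeff f k)" and C: "C \<ge> 0"
  shows "norm g \<le> C * norm f"
proof -
  have "(\<Sum>k. (norm (hcoeff g k))\<^sup>2) \<le> (\<Sum>k. C\<^sup>2 * (norm (hcoeff f k))\<^sup>2)"
    using power_mono[OF assms(1) norm_ge_zero, of _ 2]
    by (intro suminf_le summable_mult summable_hcoeff) (simp add: power_mult_distrib)
  also have "\<dots> = C\<^sup>2 * (\<Sum>k. (norm (hcoeff f k))\<^sup>2)"
    by (intro suminf_mult summable_hcoeff)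
  finally show ?thesis
    using C real_sqrt_le_mono by (fastforce simp: norm_hardy_eq real_sqrt_mult)
qed

lemma norm_hscale: "norm (c *\<^sub>C f) = norm c * norm f"
  by (simp add: norm_hardy_eq hcoeff_hscale norm_mult power_mult_distrib
      suminf_mult summable_hcoeff real_sqrt_mult)

lemma hinner_scaleR_left: "hinner (r *\<^sub>R f) g = r *\<^sub>R hinner f g"
  by (simp add: scaleR_hardy_def hinner_hscale_left scaleR_conv_of_real)

lemma hinner_scaleR_right: "hinner f (r *\<^sub>R g) = r *\<^sub>R hinner f g"
  by (metis hinner_commute hinner_scaleR_left complex_cnj_scaleR)

text \<open>Continuity lets \<open>hinner\<close> pass through norm-convergent series of vectors.
  Real and imaginary parts are bounded separately by the real Cauchy-Schwarz inequality, hence the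
  factor 2.\<close>

lemma bounded_linear_hinner_left: "bounded_linear (\<lambda>f. hinner f g)"
proof (rule bounded_linear_intro)
  fix f :: hardy
  \<comment> \<open>\<open>inner\<close> is only the real part of \<open>hinner\<close>; multiplying
    \<open>f\<close> by -i moves the imaginary part into the real part.\<close>
  have "Im (hinner f g) = inner ((- \<i>) *\<^sub>C f) g"
    by (simp add: inner_hardy_def hinner_hscale_left)
  then have "\<bar>Im (hinner f g)\<bar> \<le> norm f * norm g"
    using Cauchy_Schwarz_ineq2[of "(- \<i>) *\<^sub>C f" g] by (simp add: norm_hscale)
  moreover have "\<bar>Re (hinner f g)\<bar> \<le> norm f * norm g"
    using Cauchy_Schwarz_ineq2[of f g] by (simp add: inner_hardy_def)
  ultimately show "norm (hinner f g) \<le> norm f * (2 * norm g)"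
    using cmod_le[of "hinner f g"] by linarith
qed (simp_all add: hinner_add_left hinner_scaleR_left)

text \<open>All three claims rest on one estimate: a vector \<open>g\<close> with the expected
  coefficients is built first, and the partial sums are within \<open>C L * norm f\<close> of
  it.\<close>

lemma N0_absolutely_summable:
  assumes \<alpha>: "summable (\<lambda>n. norm (\<alpha> (Suc n)))"
  shows "(\<lambda>n. \<alpha> (Suc n) *\<^sub>C Pi0bar (Suc n) f) sums N0 \<alpha> f"
    and "hcoeff (N0 \<alpha> f) k = (\<Sum>n. \<alpha> (Suc n) * of_bool (Suc n dvd k \<and> 0 < k)) * hcoeff f k"
    and "norm (N0 \<alpha> f) \<le> (\<Sum>n. norm (\<alpha> (Suc n))) * norm f"
proof -
  \<comment> \<open>Every \<open>Suc n\<close> divides 0, so \<open>0 < k\<close> has to be required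
    separately: the projections omit the state of number 0.\<close>
  define t where "t k n = \<alpha> (Suc n) * of_bool (Suc n dvd k \<and> 0 < k)" for k n
  have t_le: "norm (t k n) \<le> norm (\<alpha> (Suc n))" for k n
    by (simp add: t_def)
  have t_norm: "summable (\<lambda>n. norm (t k n))" for k
    by (rule summable_comparison_test'[OF \<alpha>]) (simp add: t_le)
  have t: "summable (t k)" for k
    using t_norm by (rule summable_norm_cancel)
  have tail: "norm (\<Sum>n. t k (n + L)) \<le> (\<Sum>n. norm (\<alpha> (Suc (n + L))))" for k L
  proof -
    have "norm (\<Sum>n. t k (n + L)) \<le> (\<Sum>n. norm (t k (n + L)))"
      using t_norm by (intro summable_norm) (simp only: summable_iff_shift[of "\<lambda>n. norm (t k n)"])
    also have "\<dots> \<le> (\<Sum>n. norm (\<alpha> (Suc (n + L))))"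
      using t_norm \<alpha> t_le
      by (intro suminf_le) (simp_all only: summable_iff_shift[of "\<lambda>n. norm (t k n)"]
          summable_iff_shift[of "\<lambda>n. norm (\<alpha> (Suc n))"])
    finally show ?thesis .
  qed
  \<comment> \<open>This bounds the tails of \<open>t k\<close> uniformly in \<open>k\<close>; the
    uniformity turns coefficientwise convergence into convergence in norm.\<close>
  define C where "C L = (\<Sum>n. norm (\<alpha> (Suc (n + L))))" for L
  have C0: "C L \<ge> 0" for L
    using norm_ge_zero order_trans tail unfolding C_def by blast
  \<comment> \<open>The multipliers \<open>suminf (t k)\<close> are bounded by \<open>C 0\<close>,
    so the candidate limit lies in the Hardy space.\<close>
  have "summable (\<lambda>k. (norm (suminf (t k) * hcoeff f k))\<^sup>2)"
  proof (rule summable_comparison_test')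
    show "summable (\<lambda>k. (C 0)\<^sup>2 * (norm (hcoeff f k))\<^sup>2)"
      by (intro summable_mult summable_hcoeff)
    show "norm ((norm (suminf (t k) * hcoeff f k))\<^sup>2) \<le> (C 0)\<^sup>2 * (norm (hcoeff f k))\<^sup>2" for k
      using tail[of k 0]
      by (auto simp: norm_mult power_mult_distrib C_def intro!: mult_right_mono power_mono)
  qed
  then obtain g where g: "\<And>k. hcoeff g k = suminf (t k) * hcoeff f k"
    using hardy_with_coeffs by metis
  define S where "S L = (\<Sum>n<L. \<alpha> (Suc n) *\<^sub>C Pi0bar (Suc n) f)" for L
  have "hcoeff (\<alpha> (Suc n) *\<^sub>C Pi0bar (Suc n) f) k = t k n * hcoeff f k" for n k
    by (simp add: hcoeff_hscale Pi0bar t_def)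
  then have S: "hcoeff (S L) k = (\<Sum>n<L. t k n) * hcoeff f k" for L k
    by (simp only: S_def hcoeff_sum sum_distrib_right)
  have bound: "norm (S L - g) \<le> C L * norm f" for L
  proof (rule norm_hardy_le_multiple)
    fix k
    have "hcoeff (S L - g) k = - (\<Sum>n. t k (n + L)) * hcoeff f k"
      by (simp add: hcoeff_diff g S suminf_minus_initial_segment[OF t] left_diff_distrib)
    then show "norm (hcoeff (S L - g) k) \<le> C L * norm (hcoeff f k)"
      using tail[of k L] by (simp add: norm_mult C_def mult_right_mono)
  qed (rule C0)
  have "C \<longlonglongrightarrow> 0"
    using tendsto_diff[OF tendsto_const summable_LIMSEQ[OF \<alpha>], of "\<Sum>n. norm (\<alpha> (Suc n))"]
      suminf_minus_initial_segment[OF \<alpha>]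
    by (simp add: C_def[abs_def])
  then have "(\<lambda>L. C L * norm f) \<longlonglongrightarrow> 0"
    by (rule tendsto_mult_left_zero)
  then have "S \<longlonglongrightarrow> g"
    by (intro LIM_zero_cancel[of S] Lim_null_comparison[OF always_eventually[OF allI[OF bound]]])
  then have sums: "(\<lambda>n. \<alpha> (Suc n) *\<^sub>C Pi0bar (Suc n) f) sums g"
    by (simp add: sums_def S_def[abs_def])
  then have eq: "N0 \<alpha> f = g"
    by (simp add: N0_def sums_iff)
  show "(\<lambda>n. \<alpha> (Suc n) *\<^sub>C Pi0bar (Suc n) f) sums N0 \<alpha> f"
    using sums eq by simp
  show "hcoeff (N0 \<alpha> f) k = (\<Sum>n. \<alpha> (Suc n) * of_bool (Suc n dvd k \<and> 0 < k)) * hcoeff f k"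
    by (simp only: eq g t_def[abs_def])
  \<comment> \<open>Since \<open>S 0\<close> is zero, the remainder estimate at \<open>L = 0\<close>
    is the operator bound.\<close>
  show "norm (N0 \<alpha> f) \<le> (\<Sum>n. norm (\<alpha> (Suc n))) * norm f"
    using bound[of 0] by (simp add: eq S_def C_def)
qed

text \<open>Linearity is read off from the coefficients, since the multiplier of the
  \<open>k\<close>-th coefficient does not depend on the vector.\<close>

lemma N0_bounded_operator:
  assumes \<alpha>: "summable (\<lambda>n. norm (\<alpha> (Suc n)))"
  shows "bounded_operator (N0 \<alpha>)"
  unfolding bounded_operator_def
proof (intro conjI allI bounded_linear_intro)
  note coeff = N0_absolutely_summable(2)[OF \<alpha>]
  show "N0 \<alpha> (f + g) = N0 \<alpha> f + N0 \<alpha> g" for f g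
    by (rule hardy_eqI) (simp only: coeff hcoeff_add distrib_left)
  show "N0 \<alpha> (r *\<^sub>R f) = r *\<^sub>R N0 \<alpha> f" for r f
    by (rule hardy_eqI) (simp only: coeff hcoeff_scaleR mult.left_commute)
  show "N0 \<alpha> (c *\<^sub>C f) = c *\<^sub>C N0 \<alpha> f" for c f
    by (rule hardy_eqI) (simp only: coeff hcoeff_hscale mult.left_commute)
  show "norm (N0 \<alpha> f) \<le> norm f * (\<Sum>n. norm (\<alpha> (Suc n)))" for f
    using N0_absolutely_summable(3)[OF \<alpha>, of f] by (simp only: mult.commute)
qed

lemma norm_kernel:
  assumes "norm w < 1"
  shows "(norm (kernel w))\<^sup>2 = 1 / (1 - (norm w)\<^sup>2)"
proof -
  have "\<bar>(norm w)\<^sup>2\<bar> < 1"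
    using assms by (simp add: abs_square_less_1)
  then have "(\<Sum>n. ((norm w)\<^sup>2) ^ n) = 1 / (1 - (norm w)\<^sup>2)"
    by (intro suminf_geometric) simp
  moreover have "(norm (kernel w))\<^sup>2 = (\<Sum>n. (norm (hcoeff (kernel w) n))\<^sup>2)"
    by (simp add: norm_hardy_eq suminf_nonneg summable_hcoeff)
  ultimately show ?thesis
    by (simp add: kernel[OF assms] norm_power mult.commute flip: power_mult)
qed

lemma hinner_ket_bra: "hinner (ket_bra r f) g = hcoeff f r * cnj (hcoeff g r)"
  using sums_single[of r "\<lambda>k. hcoeff f k * cnj (hcoeff g k)"]
  by (simp add: hinner_def hcoeff_ket_bra sums_iff if_distrib[of "\<lambda>x. x * _"] cong: if_cong)

text \<open>The states with numbers \<open>l * n\<close> contribute a geometric series with ratio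
  \<open>norm w ^ (2 * n)\<close>; the ratio reappears as numerator because \<open>l\<close> starts
  at 1.\<close>

lemma hinner_Pi0bar_kernel:
  assumes w: "norm w < 1" and n: "n \<ge> 1"
  shows "hinner (Pi0bar n (kernel w)) (kernel w)
    = complex_of_real (norm w ^ (2 * n) / (1 - norm w ^ (2 * n)))"
proof -
  define q where "q = norm w ^ (2 * n)"
  have "\<bar>q\<bar> < 1"
    using w n by (simp add: q_def power_less_one_iff)
  then have "(\<lambda>l. q * q ^ l) sums (q * (1 / (1 - q)))"
    by (intro sums_mult geometric_sums) simp
  then have *: "(\<lambda>l. complex_of_real (q ^ Suc l)) sums complex_of_real (q / (1 - q))"
    by (subst sums_of_real_iff) simp
  have "hinner (ket_bra (Suc l * n) (kernel w)) (kernel w) = complex_of_real (q ^ Suc l)" for l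
  proof -
    have "hinner (ket_bra (Suc l * n) (kernel w)) (kernel w) = (cnj w * w) ^ (Suc l * n)"
      by (simp only: hinner_ket_bra kernel[OF w] complex_cnj_power complex_cnj_cnj power_mult_distrib)
    also have "cnj w * w = complex_of_real ((norm w)\<^sup>2)"
      by (metis complex_norm_square mult.commute of_real_power)
    finally show ?thesis
      by (simp only: q_def of_real_power flip: power_mult) (simp add: mult_ac)
  qed
  then have "(\<lambda>l. complex_of_real (q ^ Suc l)) sums hinner (Pi0bar n (kernel w)) (kernel w)"
    using bounded_linear.sums[OF bounded_linear_hinner_left Pi0bar(1)[OF n, of "kernel w"], of "kernel w"]
    by simp
  then show ?thesis
    using * sums_unique2 unfolding q_def by blast
qed

text \<open>The two normalising factors together give the inverse of
  \<open>(norm (kernel w))\<^sup>2\<close>, which is \<open>1 - (norm w)\<^sup>2\<close>; the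
  remaining inner product is expanded termwise by continuity.\<close>

lemma berezin_N0_sums:
  assumes \<alpha>: "summable (\<lambda>n. norm (\<alpha> (Suc n)))" and w: "norm w < 1"
  shows "(\<lambda>n. \<alpha> (Suc n)
      * complex_of_real ((1 - norm w ^ 2) / (1 - norm w ^ (2 * Suc n)) * norm w ^ (2 * Suc n)))
    sums berezin (N0 \<alpha>) w"
proof -
  let ?k = "kernel w"
  have "bounded_linear (N0 \<alpha>)"
    using N0_bounded_operator[OF \<alpha>] by (simp add: bounded_operator_def)
  then have "N0 \<alpha> (?k /\<^sub>R norm ?k) = N0 \<alpha> ?k /\<^sub>R norm ?k"
    by (simp add: linear_simps)
  then have "berezin (N0 \<alpha>) w = inverse ((norm ?k)\<^sup>2) *\<^sub>R hinner (N0 \<alpha> ?k) ?k"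
    by (simp add: berezin_def hinner_scaleR_left hinner_scaleR_right power2_eq_square)
  then have "berezin (N0 \<alpha>) w = complex_of_real (1 - (norm w)\<^sup>2) * hinner (N0 \<alpha> ?k) ?k"
    by (simp add: norm_kernel[OF w] scaleR_conv_of_real)
  moreover have "(\<lambda>n. complex_of_real (1 - (norm w)\<^sup>2) * hinner (\<alpha> (Suc n) *\<^sub>C Pi0bar (Suc n) ?k) ?k)
      sums (complex_of_real (1 - (norm w)\<^sup>2) * hinner (N0 \<alpha> ?k) ?k)"
    by (intro sums_mult bounded_linear.sums[OF bounded_linear_hinner_left]
        N0_absolutely_summable(1)[OF \<alpha>])
  ultimately show ?thesis
    by (simp add: hinner_hscale_left hinner_Pi0bar_kernel[OF w] mult_ac)
qed

text \<open>Cancelling \<open>1 - r\<^sup>2\<close> removes the 0/0 singularity at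
  \<open>r = 1\<close> and leaves a quotient that is continuous there.\<close>

lemma radial_factor_eq:
  fixes r :: real
  assumes "0 \<le> r" "r < 1" "m > 0"
  shows "(1 - r ^ 2) / (1 - r ^ (2 * m)) * r ^ (2 * m) = r ^ (2 * m) / (\<Sum>i<m. (r\<^sup>2) ^ i)"
proof -
  have "r\<^sup>2 < 1" "r ^ (2 * m) < 1"
    using assms by (simp_all add: power_less_one_iff)
  moreover have "1 - r ^ (2 * m) = (1 - r\<^sup>2) * (\<Sum>i<m. (r\<^sup>2) ^ i)"
    by (simp add: power_mult one_diff_power_eq)
  ultimately show ?thesis
    by simp
qed

text \<open>The denominator of the cancelled form is at least its term 1 at \<open>i = 0\<close>,
  and the numerator is at most 1. This supplies the domination, uniform in \<open>r\<close> and
  \<open>m\<close>, for the boundary limit.\<close>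

lemma radial_factor_bound:
  fixes r :: real
  assumes "0 \<le> r" "r < 1" "m > 0"
  shows "\<bar>(1 - r ^ 2) / (1 - r ^ (2 * m)) * r ^ (2 * m)\<bar> \<le> 1"
proof -
  have "(r\<^sup>2) ^ 0 \<le> (\<Sum>i<m. (r\<^sup>2) ^ i)"
    using assms by (intro member_le_sum) auto
  moreover have "r ^ (2 * m) \<le> 1"
    using assms by (simp add: power_le_one)
  ultimately show ?thesis
    using assms(1) unfolding radial_factor_eq[OF assms] by simp
qed

text \<open>At \<open>r = 1\<close> the cancelled form has numerator 1 and a denominator of
  \<open>m\<close> terms equal to 1.\<close>

lemma radial_factor_tendsto:
  assumes m: "m > 0"
  shows "((\<lambda>r. (1 - r ^ 2) / (1 - r ^ (2 * m)) * r ^ (2 * m)) \<longlongrightarrow> 1 / real m) (at_left 1)"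
proof (rule Lim_transform_eventually)
  have "((\<lambda>r::real. r ^ (2 * m) / (\<Sum>i<m. (r\<^sup>2) ^ i)) \<longlongrightarrow> 1 ^ (2 * m) / (\<Sum>i<m. (1\<^sup>2) ^ i)) (at_left 1)"
    using m by (intro tendsto_intros) auto
  then show "((\<lambda>r::real. r ^ (2 * m) / (\<Sum>i<m. (r\<^sup>2) ^ i)) \<longlongrightarrow> 1 / real m) (at_left 1)"
    by simp
  have "eventually (\<lambda>r::real. 0 < r \<and> r < 1) (at_left 1)"
    using eventually_at_left_real[of 0 1] by simp
  then show "\<forall>\<^sub>F r::real in at_left 1. r ^ (2 * m) / (\<Sum>i<m. (r\<^sup>2) ^ i)
      = (1 - r ^ 2) / (1 - r ^ (2 * m)) * r ^ (2 * m)"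
    by eventually_elim (intro radial_factor_eq[symmetric] m; simp)
qed

theorem mainTheorem3:
  fixes s :: complex and \<alpha> :: "nat \<Rightarrow> complex"
  assumes "Re s > 1"
    and "\<And>n. n \<ge> 1 \<Longrightarrow> \<alpha> n = 1 / of_nat n powr s"
  shows "(\<forall>f. (\<lambda>n. \<alpha> (Suc n) *\<^sub>C Pi0bar (Suc n) f) sums N0 \<alpha> f)
    \<and> bounded_operator (N0 \<alpha>)
    \<and> onorm (N0 \<alpha>) \<le> Re (zeta (complex_of_real (Re s)))
    \<and> (\<forall>w. norm w < 1 \<longrightarrow>
          (\<lambda>n. 1 / of_nat (Suc n) powr s
             * complex_of_real ((1 - norm w ^ 2) / (1 - norm w ^ (2 * Suc n)) * norm w ^ (2 * Suc n)))
          sums berezin (N0 \<alpha>) w)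
    \<and> (berezin (N0 \<alpha>) \<longlongrightarrow> zeta (s + 1)) (filtercomap norm (at_left 1))"
proof -
  have \<alpha>_eq: "\<alpha> (Suc n) = 1 / of_nat (Suc n) powr s" for n
    by (rule assms(2)) simp
  have norm_\<alpha>: "norm (\<alpha> (Suc n)) = 1 / real (Suc n) powr Re s" for n
    using norm_powr_real_powr[of "complex_of_nat (Suc n)" s]
    by (simp add: \<alpha>_eq norm_divide del: of_nat_Suc)
  have "summable (\<lambda>n. real (Suc n) powr (- Re s))"
    using assms(1) by (subst summable_Suc_iff) (simp add: summable_real_powr_iff)
  then have \<alpha>: "summable (\<lambda>n. norm (\<alpha> (Suc n)))"
    by (simp only: norm_\<alpha> powr_minus_divide)
  \<comment> \<open>At the real point \<open>Re s\<close> the terms of the Dirichlet series are the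
    moduli of the coefficients; \<open>Re\<close> only converts the complex value of
    \<open>zeta\<close> to a real number.\<close>
  have zeta_Re: "(\<Sum>n. norm (\<alpha> (Suc n))) = Re (zeta (complex_of_real (Re s)))"
  proof -
    have "zeta (complex_of_real (Re s)) = (\<Sum>n. complex_of_real (norm (\<alpha> (Suc n))))"
      unfolding zeta_def norm_\<alpha>
      by (intro suminf_cong) (simp flip: powr_of_real del: of_nat_Suc)
    then show ?thesis
      by (simp only: suminf_of_real[OF \<alpha>, symmetric] Re_complex_of_real)
  qed
  have berezin: "(\<lambda>n. 1 / of_nat (Suc n) powr s
        * complex_of_real ((1 - norm w ^ 2) / (1 - norm w ^ (2 * Suc n)) * norm w ^ (2 * Suc n)))
      sums berezin (N0 \<alpha>) w" if "norm w < 1" for w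
    using berezin_N0_sums[OF \<alpha> that] by (simp only: \<alpha>_eq)
  \<comment> \<open>The symbol depends on the point only through its modulus, so the limit is taken
    in one real variable \<open>r\<close>.\<close>
  define F where "F n r = 1 / of_nat (Suc n) powr s
    * complex_of_real ((1 - r ^ 2) / (1 - r ^ (2 * Suc n)) * r ^ (2 * Suc n))" for n r
  have "((\<lambda>r. \<Sum>n. F n r) \<longlongrightarrow> (\<Sum>n. 1 / of_nat (Suc n) powr (s + 1))) (at_left 1)"
  proof (rule tannerys_theorem[THEN conjunct2, THEN conjunct2])
    show "summable (\<lambda>n. norm (\<alpha> (Suc n)))" by (rule \<alpha>)
    have "eventually (\<lambda>r::real. 0 < r \<and> r < 1) (at_left 1)"
      using eventually_at_left_real[of 0 1] by simp
    \<comment> \<open>The domination holds for every \<open>n\<close> once \<open>0 < r < 1\<close>,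
      so the product filter restricts only \<open>r\<close>.\<close>
    then have "eventually (\<lambda>(n::nat, r). 0 < r \<and> r < (1::real)) (at_top \<times>\<^sub>F at_left 1)"
      using eventually_prod2[of sequentially "\<lambda>r. 0 < r \<and> r < 1" "at_left (1::real)"] by simp
    then show "\<forall>\<^sub>F (n, r) in at_top \<times>\<^sub>F at_left 1. norm (F n r) \<le> norm (\<alpha> (Suc n))"
    proof eventually_elim
      case (elim p)
      obtain n r where p: "p = (n, r)" by (cases p)
      then have "\<bar>(1 - r ^ 2) / (1 - r ^ (2 * Suc n)) * r ^ (2 * Suc n)\<bar> \<le> 1"
        using elim radial_factor_bound[of r "Suc n"] by simp
      then have "norm (F n r) \<le> norm (\<alpha> (Suc n)) * 1"
        unfolding F_def \<alpha>_eq norm_mult norm_of_real by (intro mult_left_mono) simp_all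
      then show ?case by (simp add: p)
    qed
    show "(F n \<longlongrightarrow> 1 / of_nat (Suc n) powr (s + 1)) (at_left 1)" for n
    proof -
      \<comment> \<open>The extra factor 1/n from the radial limit shifts the exponent from
        \<open>s\<close> to \<open>s + 1\<close>.\<close>
      have "(F n \<longlongrightarrow> 1 / of_nat (Suc n) powr s * complex_of_real (1 / real (Suc n))) (at_left 1)"
        unfolding F_def by (intro tendsto_mult tendsto_const tendsto_of_real radial_factor_tendsto) simp
      then show ?thesis
        by (simp add: powr_add del: of_nat_Suc)
    qed
  qed (simp_all)
  then have "((\<lambda>r. \<Sum>n. F n r) \<longlongrightarrow> zeta (s + 1)) (at_left 1)"
    by (simp only: zeta_def)
  \<comment> \<open>\<open>filtercomap norm (at_left 1)\<close> expresses approach to the unit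
    circle from inside, with no condition on the argument of \<open>w\<close>.\<close>
  then have lim: "((\<lambda>w :: complex. \<Sum>n. F n (norm w)) \<longlongrightarrow> zeta (s + 1)) (filtercomap norm (at_left 1))"
    by (rule filterlim_compose) (rule filterlim_filtercomap)
  have "eventually (\<lambda>r::real. r < 1) (at_left 1)"
    by (simp add: eventually_at_filter)
  then have "\<forall>\<^sub>F w :: complex in filtercomap norm (at_left 1). norm w < 1"
    by (rule eventually_filtercomapI)
  then have "\<forall>\<^sub>F w in filtercomap norm (at_left 1). (\<Sum>n. F n (norm w)) = berezin (N0 \<alpha>) w"
    by eventually_elim (use berezin in \<open>simp add: F_def sums_iff\<close>)
  with lim have "(berezin (N0 \<alpha>) \<longlongrightarrow> zeta (s + 1)) (filtercomap norm (at_left 1))"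
    by (rule Lim_transform_eventually)
  moreover have "onorm (N0 \<alpha>) \<le> Re (zeta (complex_of_real (Re s)))"
    unfolding zeta_Re[symmetric]
    by (intro onorm_bound suminf_nonneg \<alpha> norm_ge_zero N0_absolutely_summable(3))
  ultimately show ?thesis
    using N0_absolutely_summable(1)[OF \<alpha>] N0_bounded_operator[OF \<alpha>] berezin by blast
qed

end
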